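(* Let $p\ge1$, $\sigma>0$, $C_0>0$. Let $f$ be a locally integrable function on $\mathbb{R}^p$ with finite Besicovitch norm $\|f\|_B<\infty$, and suppose $f$ extends to $\mathbb{C}^p$ as an entire function satisfying $|f(z)|\le C_0e^{\sigma|z|}$ for all $z\in\mathbb{C}^p$. Then there is a constant $C_1<\infty$ (depending on $f$) such that $$|f(x)|\le C_1\prod_{j=1}^p(1+|x_j|)^p\qquad\text{for all } x=(x_1,\dots,x_p)\in\mathbb{R}^p.$$
   Context: $|z|$ denotes the Euclidean norm on $\mathbb{C}^p$. The Besicovitch norm of a locally integrable $f$ on $\mathbb{R}^p$ is $\|f\|_B=\limsup_{T\to\infty}(2T)^{-p}\int_{[-T,T]^p}|f(x)|\,dx$. *)

theory Defs
  imports "HOL-Analysis.Analysis"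
begin

definition cvec_of_rvec :: "real ^ 'n \<Rightarrow> complex ^ 'n" where
  "cvec_of_rvec x = (\<chi> i. complex_of_real (x $ i))"

text \<open>Entire function on C^p: complex (Frechet) differentiable at every point,
  i.e. the derivative is a complex-linear map h \<mapsto> sum_i a_i h_i.\<close>
definition entire_cn :: "(complex ^ 'n \<Rightarrow> complex) \<Rightarrow> bool" where
  "entire_cn F \<longleftrightarrow> (\<forall>z. \<exists>a :: complex ^ 'n.
      (F has_derivative (\<lambda>h. \<Sum>i\<in>UNIV. a $ i * h $ i)) (at z))"

definition locally_integrable :: "(real ^ 'n \<Rightarrow> complex) \<Rightarrow> bool" where
  "locally_integrable f \<longleftrightarrow> (\<forall>a b. set_integrable lborel (cbox a b) f)"

definition besicovitch_norm :: "(real ^ 'n \<Rightarrow> complex) \<Rightarrow> ereal" where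
  "besicovitch_norm f = Limsup at_top (\<lambda>T::real.
      ereal ((2 * T) powr (- real CARD('n)) *
        (LINT x : cbox (- (\<chi> i. T)) (\<chi> i. T) | lborel. norm (f x))))"

end

theory Submission
  imports Defs "HOL-Complex_Analysis.Complex_Analysis" "HOL-Real_Asymp.Real_Asymp"
begin

text \<open>
  On the real space, the iterated antiderivative \<open>\<Phi>\<close> of \<open>F\<close> in all \<open>p\<close> coordinates
  is bounded by the integral of \<open>|F|\<close> over a cube, so finiteness of the Besicovitch
  norm gives \<open>|\<Phi>(x)| \<le> M (1 + |x|)^p\<close>. As \<open>\<Phi>\<close> is again of exponential type,
  Phragmen-Lindelof on the complex lines \<open>w \<mapsto> x + w y\<close> carries this bound over to a strip
  around the real space. Finally \<open>F\<close> is the mixed derivative of \<open>\<Phi>\<close> in all coordinates,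
  and each of the \<open>p\<close> Cauchy estimates costs one unit of the width of the strip.
\<close>

text \<open>The hypothesis controls \<open>F\<close> only on average, whereas Phragmen-Lindelof
  needs pointwise bounds; integration from 0 in every coordinate turns an average over the cube into
  a pointwise bound, and holomorphy makes the integration reversible at bounded cost. The exponent p
  in the bound on \<Phi> comes from the volume of the cube, while the strip has radius p because p
  Cauchy circles of radius 1 have to fit into it. On a complex line, the half-plane is exactly
  critical for exponential type: exp(- i s w) is bounded on the real axis and unbounded above it.
  The factor exp(i s w) removes the growth along the imaginary ray, which cuts the half-plane into
  quadrants, where order 1 lies below the critical order 2. The growth constant of \<Phi> along x +
  w y depends on x, so it is essential that the resulting half-plane estimate contains only the type
  and the bound on the real axis. The bound obtained for \<open>F\<close> has the form C (2 +
  |x|)^p, and the product over the coordinates dominates it.\<close>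

no_notation fps_nth (infixl "$" 75)

subsection \<open>Phragmen-Lindelof principles\<close>

text \<open>The multiplier \<open>m e\<close> makes \<open>f\<close> small on large arcs, so the
  maximum principle applies on \<open>S\<close> cut off by a large disc; letting \<open>e\<close>
  tend to 0 at the fixed point \<open>w\<close> removes the multiplier. The slack \<open>e\<close>
  in \<open>far\<close> keeps the target positive even when \<open>B\<close> is 0.\<close>

lemma Phragmen_Lindelof_multiplier:
  fixes f :: "complex \<Rightarrow> complex"
  assumes S: "closed S" and f: "f holomorphic_on S"
    and fB: "\<And>z. z \<in> frontier S \<Longrightarrow> cmod (f z) \<le> B" and w: "w \<in> S" and "0 \<le> B"
    and m: "\<And>e. e > 0 \<Longrightarrow> m e holomorphic_on S"
    and m1: "\<And>e z. e > 0 \<Longrightarrow> z \<in> S \<Longrightarrow> cmod (m e z) \<le> 1"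
    and far: "\<And>e. e > 0 \<Longrightarrow> \<forall>\<^sub>F R in at_top. \<forall>z\<in>S. cmod z = R \<longrightarrow> cmod (f z * m e z) \<le> B + e"
    and lim: "((\<lambda>e. m e w) \<longlongrightarrow> 1) (at_right 0)"
  shows "cmod (f w) \<le> B"
proof -
  have le: "cmod (f w * m e w) \<le> B + e" if e: "e > 0" for e
  proof -
    obtain R where R: "cmod w \<le> R" "\<And>z. z \<in> S \<Longrightarrow> cmod z = R \<Longrightarrow> cmod (f z * m e z) \<le> B + e"
    proof -
      from far[OF e] obtain R0 where "\<And>R. R \<ge> R0 \<Longrightarrow> \<forall>z\<in>S. cmod z = R \<longrightarrow> cmod (f z * m e z) \<le> B + e"
        unfolding eventually_at_top_linorder by metis
      from this[of "max R0 (cmod w)"] that[of "max R0 (cmod w)"] show thesis by simp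
    qed
    have hol: "(\<lambda>z. f z * m e z) holomorphic_on S \<inter> cball 0 R"
      by (rule holomorphic_on_subset[OF holomorphic_on_mult[OF f m[OF e]]]) auto
    show ?thesis
    proof (rule maximum_modulus_frontier[where S = "S \<inter> cball 0 R" and f = "\<lambda>z. f z * m e z"])
      show "(\<lambda>z. f z * m e z) holomorphic_on interior (S \<inter> cball 0 R)"
        by (rule holomorphic_on_subset[OF hol interior_subset])
      have "closed (S \<inter> cball 0 R)" using S by blast
      then show "continuous_on (closure (S \<inter> cball 0 R)) (\<lambda>z. f z * m e z)"
        using holomorphic_on_imp_continuous_on[OF hol] by (simp add: closure_closed)
      show "bounded (S \<inter> cball 0 R)" by (simp add: bounded_Int)
      show "w \<in> S \<inter> cball 0 R" using w R by auto
      fix z assume z: "z \<in> frontier (S \<inter> cball 0 R)"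
      then have zS: "z \<in> S" using S
        by (metis IntD1 closed_Int closed_cball closure_closed DiffD1 frontier_def)
      consider "z \<in> frontier S" | "z \<in> frontier (cball 0 R)"
        using z frontier_Int_subset by blast
      then show "cmod (f z * m e z) \<le> B + e"
      proof cases
        case 1
        have "cmod (f z) * cmod (m e z) \<le> B * 1"
          using fB[OF 1] m1[OF e zS] \<open>0 \<le> B\<close> by (intro mult_mono) auto
        then show ?thesis using e by (simp add: norm_mult)
      next
        case 2 then show ?thesis using R(2)[OF zS] by (auto simp: frontier_cball)
      qed
    qed
  qed
  have "((\<lambda>e. cmod (f w * m e w)) \<longlongrightarrow> cmod (f w * 1)) (at_right 0)"
    by (intro tendsto_intros lim)
  moreover have "((\<lambda>e. B + e) \<longlongrightarrow> B + 0) (at_right (0::real))"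
    by (intro tendsto_intros)
  moreover have "\<forall>\<^sub>F e in at_right 0. cmod (f w * m e w) \<le> B + e"
    using eventually_at_right_less[of 0] by eventually_elim (rule le)
  ultimately show ?thesis
    using tendsto_le[OF trivial_limit_at_right_real] by fastforce
qed

text \<open>For an argument of at most \<pi>/4 the root a + i b has argument at most \<pi>/8, and
  tan(\<pi>/8)^2 = 3 - 2 sqrt 2 is below 1/5, so b^2 \<le> a^2/5. This gives 1 - 3/5 = 2/5 in a (a^2
  - 3 b^2), and 6/5 in a^2 + b^2.\<close>

lemma Re_csqrt_cube_ge:
  assumes "\<bar>Im v\<bar> \<le> Re v"
  shows "(Re (csqrt v)) ^ 3 * (2/5) \<le> Re (csqrt v ^ 3)" and "cmod v \<le> 6/5 * (Re (csqrt v))\<^sup>2"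
proof -
  define a b where "a = Re (csqrt v)" and "b = Im (csqrt v)"
  have a: "a \<ge> 0" unfolding a_def using csqrt_principal[of v] by auto
  have v: "v = (Complex a b)\<^sup>2" unfolding a_def b_def complex_surj power2_csqrt ..
  have re: "Re v = a\<^sup>2 - b\<^sup>2" and im: "Im v = 2 * a * b"
    unfolding v by (simp_all add: power2_eq_square)
  have ab: "2 * a * \<bar>b\<bar> \<le> a\<^sup>2 - b\<^sup>2"
    using assms a unfolding re im by (simp add: abs_mult)
  have b: "5 * b\<^sup>2 \<le> a\<^sup>2"
  proof (rule ccontr)
    assume n: "\<not> 5 * b\<^sup>2 \<le> a\<^sup>2"
    \<comment> \<open>Below the slope 2/5 the claim holds since 4/25 < 1/5; above it, 2 a |b| is at
      least 4/5 a^2, and \<open>ab\<close> leaves at most a^2/5 for b^2.\<close>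
    have "2 * a \<le> 5 * \<bar>b\<bar>"
    proof (rule ccontr)
      assume "\<not> 2 * a \<le> 5 * \<bar>b\<bar>"
      then have "5 * \<bar>b\<bar> < 2 * a" by simp
      then have "(5 * \<bar>b\<bar>)\<^sup>2 \<le> (2*a)\<^sup>2" by (intro power_mono) auto
      then have "25 * b\<^sup>2 \<le> 4 * a\<^sup>2" by (simp add: power_mult_distrib)
      then show False using n zero_le_power2[of b] by linarith
    qed
    then have "a * (2 * a) \<le> a * (5 * \<bar>b\<bar>)" using a by (rule mult_left_mono)
    with ab n show False by (simp add: power2_eq_square algebra_simps)
  qed
  have "Re (csqrt v ^ 3) = a * (a\<^sup>2 - 3 * b\<^sup>2)"
    unfolding a_def b_def by (simp add: power3_eq_cube power2_eq_square algebra_simps)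
  moreover have "a * (2/5 * a\<^sup>2) \<le> a * (a\<^sup>2 - 3 * b\<^sup>2)"
    using a b by (intro mult_left_mono) auto
  ultimately show "(Re (csqrt v)) ^ 3 * (2/5) \<le> Re (csqrt v ^ 3)"
    by (simp add: a_def power3_eq_cube power2_eq_square algebra_simps)
  have "cmod v = a\<^sup>2 + b\<^sup>2"
    unfolding v norm_power by (simp add: cmod_def)
  then show "cmod v \<le> 6/5 * (Re (csqrt v))\<^sup>2" using b by (simp add: a_def)
qed

text \<open>A sector of opening \<pi>/2 tolerates every growth order below 2, so for order 1 there
  is room for a barrier of intermediate order. Its position, symmetric about the positive axis,
  suits the principal square root.\<close>

lemma Phragmen_Lindelof_sector:
  fixes f :: "complex \<Rightarrow> complex"
  defines "S \<equiv> {v. \<bar>Im v\<bar> \<le> Re v}"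
  assumes f: "f holomorphic_on S"
    and fB: "\<And>v. \<bar>Im v\<bar> = Re v \<Longrightarrow> cmod (f v) \<le> B" and "0 \<le> B"
    and growth: "\<And>v. v \<in> S \<Longrightarrow> cmod (f v) \<le> A * exp (s * cmod v)" and "0 \<le> s"
    and w: "w \<in> S"
  shows "cmod (f w) \<le> B"
proof -
  \<comment> \<open>A barrier of order \<open>3/2\<close>; the shift by 1 keeps it holomorphic at the vertex.\<close>
  define m where "m e v = exp (- of_real e * csqrt (v + 1) ^ 3)" for e :: real and v
  have cone: "\<bar>Im (v + 1)\<bar> \<le> Re (v + 1)" if "v \<in> S" for v
    using that by (auto simp: S_def)
  have norm_m: "cmod (m e v) \<le> exp (- (e * ((Re (csqrt (v + 1))) ^ 3 * (2/5))))"
    if "e > 0" "v \<in> S" for e v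
    using Re_csqrt_cube_ge(1)[OF cone[OF that(2)]] that(1) by (simp add: m_def)
  show ?thesis
  proof (rule Phragmen_Lindelof_multiplier[of S f B w m])
    have "S = {v. \<bar>Im v\<bar> - Re v \<le> 0}" by (auto simp: S_def)
    also have "closed \<dots>" by (intro closed_Collect_le continuous_intros)
    finally show "closed S" .
    show "cmod (f z) \<le> B" if z: "z \<in> frontier S" for z
    proof (rule fB)
      have "open {v. \<bar>Im v\<bar> < Re v}" by (intro open_Collect_less continuous_intros)
      then have "{v. \<bar>Im v\<bar> < Re v} \<subseteq> interior S" by (intro interior_maximal) (auto simp: S_def)
      then show "\<bar>Im z\<bar> = Re z" using z \<open>closed S\<close> by (force simp: frontier_def S_def)
    qed
    fix e :: real assume e: "e > 0"
    show "m e holomorphic_on S" unfolding m_def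
    proof (intro holomorphic_intros)
      fix z assume "z \<in> S" then show "z + 1 \<notin> \<real>\<^sub>\<le>\<^sub>0"
        using cone[of z] by (auto simp: complex_nonpos_Reals_iff S_def)
    qed
    show "cmod (m e z) \<le> 1" if "z \<in> S" for z
    proof -
      have "0 \<le> e * ((Re (csqrt (z + 1))) ^ 3 * (2/5))"
        using e csqrt_principal[of "z+1"] by auto
      then show ?thesis using order_trans[OF norm_m[OF e that]] by simp
    qed
    \<comment> \<open>\<open>h a\<close> majorizes the product at points where the root of z + 1 has
      real part \<open>a\<close>: the growth of \<open>f\<close> is quadratic in the exponent, the
      decay of the barrier cubic.\<close>
    define h where "h a = \<bar>A\<bar> * exp (s * (6/5 * a\<^sup>2 + 1) - e * (a ^ 3 * (2/5)))" for a
    have "(h \<longlongrightarrow> 0) at_top" 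
      using e unfolding h_def by real_asymp
    then have "\<forall>\<^sub>F a in at_top. h a \<le> B + e"
      using e \<open>0 \<le> B\<close> by (auto dest!: order_tendstoD(2)[where a = "B + e"] elim: eventually_mono)
    then obtain a0 where a0: "\<And>a. a \<ge> a0 \<Longrightarrow> h a \<le> B + e" by (auto simp: eventually_at_top_linorder)
    show "\<forall>\<^sub>F R in at_top. \<forall>z\<in>S. cmod z = R \<longrightarrow> cmod (f z * m e z) \<le> B + e"
      \<comment> \<open>Since |z| \<le> 6/5 a^2 + 1 in the sector, a modulus this large forces
        \<open>a0 \<le> a\<close>.\<close>
      using eventually_ge_at_top[of "6/5 * a0\<^sup>2 + 1"]
    proof eventually_elim
      case (elim R)
      show ?case
      proof (intro ballI impI)
        fix z assume z: "z \<in> S" "cmod z = R"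
        define a where "a = Re (csqrt (z + 1))"
        have a: "a \<ge> 0" unfolding a_def using csqrt_principal[of "z+1"] by auto
        have "cmod z \<le> cmod (z + 1) + 1" using norm_triangle_ineq4[of "z+1" 1] by simp
        then have Ra: "cmod z \<le> 6/5 * a\<^sup>2 + 1"
          using Re_csqrt_cube_ge(2)[OF cone[OF z(1)]] by (simp add: a_def)
        then have "a0\<^sup>2 \<le> a\<^sup>2" using elim z by simp
        then have "a0 \<le> a" using a by (rule power2_le_imp_le)
        have "s * cmod z \<le> s * (6/5 * a\<^sup>2 + 1)" using Ra \<open>0 \<le> s\<close> by (rule mult_left_mono)
        then have "cmod (f z) \<le> \<bar>A\<bar> * exp (s * (6/5 * a\<^sup>2 + 1))"
          by (intro order_trans[OF growth[OF z(1)]] mult_mono) auto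
        then have "cmod (f z * m e z) \<le> h a"
          using norm_m[OF e z(1)] unfolding norm_mult h_def a_def diff_conv_add_uminus exp_add mult.assoc[symmetric]
          by (intro mult_mono) (auto simp: mult.assoc)
        with a0[OF \<open>a0 \<le> a\<close>] show "cmod (f z * m e z) \<le> B + e" by simp
      qed
    qed
  next
    have "((\<lambda>e. m e w) \<longlongrightarrow> exp (- of_real 0 * csqrt (w + 1) ^ 3)) (at_right 0)"
      unfolding m_def by (intro tendsto_intros)
    then show "((\<lambda>e. m e w) \<longlongrightarrow> 1) (at_right 0)" by simp
  qed (use assms in auto)
qed

text \<open>The bound \<open>N\<close> on the imaginary ray enters only qualitatively: it yields
  boundedness on the half-plane, after which the real axis alone determines the constant.\<close>

lemma Phragmen_Lindelof_upper_half_plane: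
  fixes f :: "complex \<Rightarrow> complex"
  defines "H \<equiv> {w. 0 \<le> Im w}"
  assumes f: "f holomorphic_on H"
    and growth: "\<And>w. w \<in> H \<Longrightarrow> cmod (f w) \<le> A * exp (s * cmod w)" and "0 \<le> s"
    and imag: "\<And>w. Re w = 0 \<Longrightarrow> w \<in> H \<Longrightarrow> cmod (f w) \<le> N"
    and real: "\<And>w. Im w = 0 \<Longrightarrow> cmod (f w) \<le> B"
    and w: "w \<in> H"
  shows "cmod (f w) \<le> B"
proof -
  define M where "M = max B N"
  have "0 \<le> B" using real[of 0] order_trans[OF norm_ge_zero] by fastforce
  then have "0 \<le> M" by (simp add: M_def)
  have "A \<ge> 0" using order_trans[OF norm_ge_zero growth[of 0]] by (simp add: H_def)
  \<comment> \<open>Rotating each quadrant onto the sector first gives boundedness, with a constant involving \<open>N\<close>.\<close>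
  have quadrant: "cmod (f (c * v)) \<le> M"
    if c: "c = Complex 1 1 \<or> c = Complex (-1) 1" and v: "\<bar>Im v\<bar> \<le> Re v" for c v
  proof (rule Phragmen_Lindelof_sector[of "\<lambda>v. f (c * v)"])
    have cH: "c * v \<in> H" if "\<bar>Im v\<bar> \<le> Re v" for v
      using c that by (auto simp: H_def)
    have "(f \<circ> (\<lambda>v. c * v)) holomorphic_on {v. \<bar>Im v\<bar> \<le> Re v}"
      using cH by (intro holomorphic_on_compose_gen[OF _ f] holomorphic_intros) auto
    then show "(\<lambda>v. f (c * v)) holomorphic_on {v. \<bar>Im v\<bar> \<le> Re v}" by (simp add: o_def)
    show "cmod (f (c * v)) \<le> M" if b: "\<bar>Im v\<bar> = Re v" for v
    proof -
      have "Re (c * v) = 0 \<or> Im (c * v) = 0" using c b by auto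
      then show ?thesis using imag[of "c * v"] real[of "c * v"] cH[of v] b by (auto simp: M_def)
    qed
    have nc: "cmod c \<le> 2" using c by (auto simp: cmod_def real_le_lsqrt)
    show "cmod (f (c * v)) \<le> A * exp (2 * s * cmod v)" if "v \<in> {v. \<bar>Im v\<bar> \<le> Re v}" for v
    proof -
      have "s * cmod (c * v) \<le> s * (2 * cmod v)"
        using nc \<open>0 \<le> s\<close> by (intro mult_left_mono) (auto simp: norm_mult mult_right_mono)
      then have "A * exp (s * cmod (c * v)) \<le> A * exp (2 * s * cmod v)"
        using \<open>A \<ge> 0\<close> by (intro mult_left_mono) (auto simp: mult_ac)
      then show ?thesis using growth[OF cH[of v]] that by auto
    qed
  qed (use \<open>0 \<le> M\<close> \<open>0 \<le> s\<close> v in auto)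
  have bdd: "cmod (f z) \<le> M" if z: "z \<in> H" for z
  proof -
    define c where "c = (if Re z \<ge> 0 then Complex 1 1 else Complex (-1) 1)"
    have "c \<noteq> 0" by (auto simp: c_def Complex_eq_0)
    have "\<bar>Im (z / c)\<bar> \<le> Re (z / c)"
      using z by (auto simp: c_def H_def Re_divide Im_divide field_simps abs_if split: if_splits)
    from quadrant[OF _ this, of c] show ?thesis using \<open>c \<noteq> 0\<close> by (auto simp: c_def)
  qed
  \<comment> \<open>As \<open>f\<close> is now known to be bounded, decay like 1/|z| suffices. The
    pole -i/e lies in the lower half-plane.\<close>
  define m where "m e z = inverse (1 - \<i> * of_real e * z)" for e :: real and z
  have den: "1 \<le> cmod (1 - \<i> * of_real e * z)" "e * cmod z - 1 \<le> cmod (1 - \<i> * of_real e * z)"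
    if "e > 0" "z \<in> H" for e z
  proof -
    have "1 \<le> Re (1 - \<i> * of_real e * z)" using that by (simp add: H_def)
    then show "1 \<le> cmod (1 - \<i> * of_real e * z)" using complex_Re_le_cmod order_trans by blast
    have "cmod (\<i> * of_real e * z) = e * cmod z" using that by (simp add: norm_mult)
    then show "e * cmod z - 1 \<le> cmod (1 - \<i> * of_real e * z)"
      using norm_triangle_ineq2[of "\<i> * of_real e * z" 1] by (simp add: norm_minus_commute)
  qed
  show ?thesis
  proof (rule Phragmen_Lindelof_multiplier[of H f B w m])
    show "closed H" unfolding H_def by (intro closed_Collect_le continuous_intros)
    show "cmod (f z) \<le> B" if z: "z \<in> frontier H" for z
    proof (rule real)
      have "open {v. 0 < Im v}" by (intro open_Collect_less continuous_intros)
      then have "{v. 0 < Im v} \<subseteq> interior H" by (intro interior_maximal) (auto simp: H_def)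
      then show "Im z = 0" using z \<open>closed H\<close> by (force simp: frontier_def H_def)
    qed
    fix e :: real assume e: "e > 0"
    show "m e holomorphic_on H" unfolding m_def
      using den(1)[OF e] by (intro holomorphic_intros) fastforce
    show "cmod (m e z) \<le> 1" if "z \<in> H" for z
      using den(1)[OF e that] by (simp add: m_def norm_inverse inverse_le_1_iff)
    show "\<forall>\<^sub>F R in at_top. \<forall>z\<in>H. cmod z = R \<longrightarrow> cmod (f z * m e z) \<le> B + e"
      using eventually_ge_at_top[of "(M / e + 1) / e"]
    proof eventually_elim
      case (elim R)
      show ?case
      proof (intro ballI impI)
        fix z assume z: "z \<in> H" "cmod z = R"
        have "M / e \<le> e * cmod z - 1" using elim z e by (simp add: field_simps)
        also have "\<dots> \<le> cmod (1 - \<i> * of_real e * z)" by (rule den(2)[OF e z(1)])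
        finally have "M \<le> e * cmod (1 - \<i> * of_real e * z)" using e by (simp add: field_simps)
        then have "cmod (f z) \<le> e * cmod (1 - \<i> * of_real e * z)" using bdd[OF z(1)] by simp
        then have "cmod (f z) / cmod (1 - \<i> * of_real e * z) \<le> e"
          using den(1)[OF e z(1)] by (subst pos_divide_le_eq) auto
        then have "cmod (f z * m e z) \<le> e" by (simp add: m_def norm_mult norm_inverse divide_inverse)
        then show "cmod (f z * m e z) \<le> B + e" using \<open>0 \<le> B\<close> by simp
      qed
    qed
  next
    have "((\<lambda>e. m e w) \<longlongrightarrow> inverse (1 - \<i> * of_real 0 * w)) (at_right 0)"
      unfolding m_def by (intro tendsto_intros) auto
    then show "((\<lambda>e. m e w) \<longlongrightarrow> 1) (at_right 0)" by simp
  qed (use assms \<open>0 \<le> B\<close> in auto)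
qed

text \<open>Evaluation at the single point i is enough, because every complex vector x + i y is the
  value at i of the line w -> x + w y. The factor exp(i s w) has modulus exp(- s Im w), which
  cancels the growth exactly on the imaginary ray, where |w| = Im w; undoing both factors at i costs
  exp s and (K + 1)^n. The growth constant \<open>A\<close> does not survive into the conclusion,
  which is what permits uniformity in x.\<close>

lemma exponential_type_bound_at_ii:
  fixes f :: "complex \<Rightarrow> complex"
  assumes f: "f holomorphic_on UNIV"
    and growth: "\<And>w. cmod (f w) \<le> A * exp (s * cmod w)" and "0 \<le> s"
    and real: "\<And>t. cmod (f (of_real t)) \<le> D * (K + \<bar>t\<bar>) ^ n" and "1 \<le> K"
  shows "cmod (f \<i>) \<le> D * 2 ^ n * (K + 1) ^ n * exp s"
proof -
  define H where "H = {w. 0 \<le> Im w}"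
  \<comment> \<open>The pole of the denominator lies below the half-plane, and on the real line
    \<open>|t + \<i>K|\<close> is comparable to \<open>K + |t|\<close>.\<close>
  define g where "g w = f w * exp (\<i> * of_real s * w) / (w + \<i> * of_real K) ^ n" for w
  have A: "A \<ge> 0" using order_trans[OF norm_ge_zero growth[of 0]] by simp
  have "0 \<le> D * K ^ n" using order_trans[OF norm_ge_zero real[of 0]] by simp
  moreover have "0 < K ^ n" using \<open>1 \<le> K\<close> by simp
  ultimately have D: "0 \<le> D" by (simp add: zero_le_mult_iff)
  have norm_g: "cmod (g w) = cmod (f w) * exp (- (s * Im w)) / cmod (w + \<i> * of_real K) ^ n" for w
    by (simp add: g_def norm_mult norm_divide norm_power)
  have den: "1 \<le> cmod (w + \<i> * of_real K)" if "w \<in> H" for w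
    using abs_Im_le_cmod[of "w + \<i> * of_real K"] that \<open>1 \<le> K\<close> by (simp add: H_def)
  have g_le: "cmod (g w) \<le> A * exp (s * cmod w - s * Im w)" if "w \<in> H" for w
  proof -
    have "cmod (g w) \<le> cmod (f w) * exp (- (s * Im w)) / 1"
      unfolding norm_g using den[OF that] by (intro divide_left_mono) (auto intro!: one_le_power zero_less_power)
    also have "\<dots> \<le> A * exp (s * cmod w) * exp (- (s * Im w))"
      using growth by (simp add: mult_right_mono)
    also have "\<dots> = A * exp (s * cmod w - s * Im w)" by (simp add: exp_diff exp_minus field_simps)
    finally show ?thesis .
  qed
  have "cmod (g \<i>) \<le> D * 2 ^ n"
  proof (rule Phragmen_Lindelof_upper_half_plane[of g A s A, folded H_def])
    have "w + \<i> * of_real K \<noteq> 0" if "w \<in> H" for w using den[OF that] by fastforce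
    then show "g holomorphic_on H" unfolding g_def
      by (intro holomorphic_intros holomorphic_on_subset[OF f]) auto
    show "cmod (g w) \<le> A * exp (s * cmod w)" if "w \<in> H" for w
      using g_le[OF that] A \<open>0 \<le> s\<close> that
      by (elim order_trans) (auto intro!: mult_left_mono simp: H_def)
    show "cmod (g w) \<le> A" if "Re w = 0" "w \<in> H" for w
      using g_le[OF that(2)] that by (simp add: cmod_def H_def)
    show "cmod (g w) \<le> D * 2 ^ n" if w: "Im w = 0" for w
    proof -
      obtain t where t: "w = of_real t" using w by (metis complex_is_Real_iff Reals_cases)
      have "K + \<bar>t\<bar> \<le> 2 * cmod (w + \<i> * of_real K)"
        using abs_Re_le_cmod[of "w + \<i> * of_real K"] abs_Im_le_cmod[of "w + \<i> * of_real K"] t by simp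
      then have "(K + \<bar>t\<bar>) ^ n \<le> (2 * cmod (w + \<i> * of_real K)) ^ n"
        using \<open>1 \<le> K\<close> by (intro power_mono) auto
      then have "cmod (f w) \<le> D * 2 ^ n * cmod (w + \<i> * of_real K) ^ n"
        using real[of t] mult_left_mono[OF _ D] t by (force simp: power_mult_distrib mult.assoc)
      then show ?thesis unfolding norm_g using w den[of w]
        by (subst pos_divide_le_eq) (auto simp: H_def intro!: zero_less_power)
    qed
  qed (auto simp: H_def \<open>0 \<le> s\<close>)
  moreover have "cmod (\<i> + \<i> * of_real K) = K + 1"
    using \<open>1 \<le> K\<close> by (simp add: cmod_def)
  ultimately show ?thesis
    using \<open>1 \<le> K\<close> unfolding norm_g by (simp add: exp_minus field_simps)
qed

subsection \<open>Antiderivatives in one coordinate\<close>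

lemma contour_integral_linepath_0_1:
  "contour_integral (linepath 0 1) g = integral {0..1} (\<lambda>x. g (of_real x))"
  by (simp add: contour_integral_linepath_Reals_eq)

lemma continuous_on_contour_integral_param:
  fixes f :: "'a::topological_space \<Rightarrow> complex \<Rightarrow> complex"
  assumes "continuous_on UNIV (\<lambda>(w, t). f w t)"
  shows "continuous_on UNIV (\<lambda>w. contour_integral (linepath 0 1) (f w))"
proof -
  have "continuous_on (UNIV \<times> cbox 0 1) (\<lambda>(w, t). f w (complex_of_real t))"
    unfolding split_beta
    by (rule continuous_on_compose2[OF assms[unfolded split_beta], of _ "\<lambda>x. (fst x, of_real (snd x))", simplified])
       (intro continuous_intros)
  from integral_continuous_on_param[OF this] show ?thesis
    by (simp add: contour_integral_linepath_0_1)
qed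

text \<open>Morera and Fubini: the integral of \<open>I\<close> over a triangle is the integral over
  t of triangle integrals of \<open>f\<close>, each zero by Cauchy. No differentiation under the
  integral sign occurs.\<close>

lemma holomorphic_contour_integral_param:
  fixes f :: "complex \<Rightarrow> complex \<Rightarrow> complex"
  assumes cont: "continuous_on UNIV (\<lambda>(w, t). f w t)"
    and hol: "\<And>t. (\<lambda>w. f w t) holomorphic_on UNIV"
  shows "(\<lambda>w. contour_integral (linepath 0 1) (f w)) holomorphic_on UNIV"
proof -
  define I where "I = (\<lambda>w. contour_integral (linepath 0 1) (f w))"
  define J where "J a b t = contour_integral (linepath a b) (\<lambda>w. f w t)" for a b t
  have contI: "continuous_on UNIV I"
    unfolding I_def by (rule continuous_on_contour_integral_param[OF cont])
  have contw: "continuous_on A (\<lambda>w. f w t)" for t A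
    using hol holomorphic_on_imp_continuous_on holomorphic_on_subset by blast
  have swap: "contour_integral (linepath a b) I = contour_integral (linepath 0 1) (J a b)" for a b
    unfolding I_def J_def
    by (rule contour_integral_swap) (auto intro: continuous_on_subset[OF cont])
  have int: "J a b contour_integrable_on linepath 0 1" for a b
  proof (rule contour_integrable_continuous_linepath)
    define h where "h t s = f (linepath a b s) t * (b - a)" for t s
    have "continuous_on (UNIV \<times> cbox 0 1) (\<lambda>(t, s). h t s)"
      unfolding h_def split_beta linepath_def
      by (intro continuous_intros continuous_on_compose2[OF cont[unfolded split_beta],
            of _ "\<lambda>x. ((1 - snd x) *\<^sub>R a + snd x *\<^sub>R b, fst x)", simplified])
    from integral_continuous_on_param[OF this]
    show "continuous_on (closed_segment 0 1) (J a b)"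
      unfolding J_def contour_integral_integral h_def
      by (rule continuous_on_subset[THEN continuous_on_eq]) (auto simp: intro!: integral_cong)
  qed
  have "I analytic_on UNIV"
  proof (rule Morera_triangle[OF contI open_UNIV], rule impI)
    fix a b c :: complex
    have "contour_integral (linepath 0 1) (\<lambda>t. J a b t + J b c t + J c a t) = 
      contour_integral (linepath 0 1) (\<lambda>t. 0)"
    proof (rule contour_integral_cong[OF refl])
      fix t
      have "((\<lambda>w. f w t) has_contour_integral 0) (linepath a b +++ linepath b c +++ linepath c a)"
        by (rule Cauchy_theorem_triangle) (rule holomorphic_on_subset[OF hol subset_UNIV])
      from has_chain_integral_chain_integral3[OF this]
      show "J a b t + J b c t + J c a t = 0" by (simp add: J_def)
    qed
    then show "contour_integral (linepath a b) I + contour_integral (linepath b c) I +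
        contour_integral (linepath c a) I = 0"
      unfolding swap using int by (simp add: contour_integral_add contour_integrable_add)
  qed
  then show ?thesis unfolding I_def by (simp add: analytic_on_open)
qed

section \<open>Antidifferentiation within the class of entire functions of exponential type\<close>

definition vec_upd :: "'a ^ 'n \<Rightarrow> 'n \<Rightarrow> 'a \<Rightarrow> 'a ^ 'n" where
  "vec_upd z j c = (\<chi> i. if i = j then c else z $ i)"

lemma norm_axis: "norm (axis j x) = norm x"
  by (simp add: norm_vec_def L2_set_def axis_def if_distrib[of norm] if_distrib[of "\<lambda>x. x\<^sup>2"] cong: if_cong)

text \<open>This is the integral of \<open>u\<close> over the j-th coordinate from 0 to
  \<open>z $ j\<close>, rescaled to a fixed segment so that \<open>z\<close> enters only through the
  integrand and the outer factor.\<close>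

definition coord_prim :: "'n \<Rightarrow> (complex ^ 'n \<Rightarrow> complex) \<Rightarrow> complex ^ 'n \<Rightarrow> complex" where
  "coord_prim j u z = z $ j * contour_integral (linepath 0 1) (\<lambda>t. u (vec_upd z j (t * z $ j)))"

text \<open>Only holomorphy along complex lines is recorded, since that is what is easily seen to be
  stable under taking antiderivatives.\<close>

definition exp_type_entire :: "(complex ^ 'n \<Rightarrow> complex) \<Rightarrow> bool" where
  "exp_type_entire u \<longleftrightarrow> continuous_on UNIV u \<and>
     (\<forall>x y. (\<lambda>w. u (\<chi> i. x $ i + w * y $ i)) holomorphic_on UNIV) \<and>
     (\<exists>A s. 0 \<le> s \<and> (\<forall>z. cmod (u z) \<le> A * exp (s * norm z)))"

lemma exp_type_entireD:
  assumes "exp_type_entire u"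
  shows "continuous_on UNIV u"
    and "(\<lambda>w. u (\<chi> i. x $ i + w * y $ i)) holomorphic_on UNIV"
  using assms by (auto simp: exp_type_entire_def)

lemma holomorphic_vec_upd:
  assumes "exp_type_entire u"
  shows "(\<lambda>c. u (vec_upd z j c)) holomorphic_on UNIV"
proof -
  have "(\<chi> i. vec_upd z j 0 $ i + w * axis j 1 $ i) = vec_upd z j w" for w
    by (simp add: vec_eq_iff vec_upd_def axis_def)
  with exp_type_entireD(2)[OF assms, of "vec_upd z j 0" "axis j 1"] show ?thesis by simp
qed

lemma continuous_on_vec_upd_scaled:
  "continuous_on UNIV (\<lambda>(z, t). vec_upd z j (t * z $ j) :: complex ^ 'n)"
proof -
  have "continuous_on UNIV (\<lambda>x. if i = j then snd x * fst x $ j else fst x $ i :: complex)" for i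
    by (cases "i = j") (auto intro!: continuous_intros)
  then show ?thesis
    unfolding vec_upd_def split_beta by (rule continuous_on_vec_lambda)
qed

text \<open>Scaling the j-th coordinate by a fixed t maps complex lines to complex lines, so the
  integrand stays holomorphic along lines. It also does not increase the norm for |t| \<le> 1; the
  outer factor \<open>z $ j\<close> is absorbed by raising the type by 1, which is harmless because
  only the existence of some type is recorded.\<close>

lemma coord_prim_exp_type_entire:
  fixes u :: "complex ^ 'n \<Rightarrow> complex"
  assumes u: "exp_type_entire u"
  shows "exp_type_entire (coord_prim j u)"
  unfolding exp_type_entire_def
proof (intro conjI allI)
  have cont: "continuous_on UNIV (\<lambda>(z, t). u (vec_upd z j (t * z $ j)))"
    using continuous_on_compose2[OF exp_type_entireD(1)[OF u] continuous_on_vec_upd_scaled]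
    by (simp add: split_beta)
  then show "continuous_on UNIV (coord_prim j u)"
    unfolding coord_prim_def by (intro continuous_intros continuous_on_contour_integral_param)
  show "(\<lambda>w. coord_prim j u (\<chi> i. x $ i + w * y $ i)) holomorphic_on UNIV" for x y
    unfolding coord_prim_def
  proof (intro holomorphic_intros holomorphic_contour_integral_param)
    have "continuous_on UNIV (\<lambda>p. ((\<chi> i. x $ i + fst p * y $ i), snd p) :: (complex ^ 'n) \<times> complex)"
      by (intro continuous_intros continuous_on_vec_lambda)
    from continuous_on_compose2[OF cont this]
    show "continuous_on UNIV (\<lambda>(w, t). u (vec_upd (\<chi> i. x $ i + w * y $ i) j
         (t * (\<chi> i. x $ i + w * y $ i) $ j)))"
      by (simp add: split_beta)
    fix t
    have "vec_upd (\<chi> i. x $ i + w * y $ i) j (t * (\<chi> i. x $ i + w * y $ i) $ j) =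
      (\<chi> i. vec_upd x j (t * x $ j) $ i + w * vec_upd y j (t * y $ j) $ i)" for w
      by (simp add: vec_upd_def vec_eq_iff algebra_simps)
    then show "(\<lambda>w. u (vec_upd (\<chi> i. x $ i + w * y $ i) j
         (t * (\<chi> i. x $ i + w * y $ i) $ j))) holomorphic_on UNIV"
      using exp_type_entireD(2)[OF u, of "vec_upd x j (t * x $ j)" "vec_upd y j (t * y $ j)"] by simp
  qed (simp, intro holomorphic_intros)
  obtain A s where s: "0 \<le> s" and A: "\<And>z. cmod (u z) \<le> A * exp (s * norm z)"
    using u by (auto simp: exp_type_entire_def)
  have "0 \<le> A" using order_trans[OF norm_ge_zero A[of 0]] by simp
  have "cmod (coord_prim j u z) \<le> A * exp ((s + 1) * norm z)" for z
  proof -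
    have "cmod (contour_integral (linepath 0 1) (\<lambda>t. u (vec_upd z j (t * z $ j)))) \<le>
        (A * exp (s * norm z)) * norm (1 - 0 :: complex)"
    proof (rule contour_integral_bound_linepath)
      have "continuous_on (closed_segment 0 1) (\<lambda>t. u (vec_upd z j (t * z $ j)))"
        using continuous_on_compose2[OF cont, of "closed_segment 0 1" "\<lambda>t. (z, t)"]
        by (simp add: continuous_on_Pair continuous_on_id)
      then show "(\<lambda>t. u (vec_upd z j (t * z $ j))) contour_integrable_on linepath 0 1"
        by (rule contour_integrable_continuous_linepath)
      fix t :: complex assume "t \<in> closed_segment 0 1"
      then have "cmod t \<le> 1" by (auto simp: closed_segment_def norm_mult)
      then have "norm (vec_upd z j (t * z $ j)) \<le> norm z"
        by (intro norm_le_componentwise_cart) (auto simp: vec_upd_def norm_mult mult_left_le_one_le)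
      then show "cmod (u (vec_upd z j (t * z $ j))) \<le> A * exp (s * norm z)"
        using s \<open>0 \<le> A\<close> by (intro order_trans[OF A]) (simp add: mult_left_mono)
    qed (use \<open>0 \<le> A\<close> in auto)
    moreover have "cmod (z $ j) \<le> exp (norm z)"
      using Finite_Cartesian_Product.norm_nth_le[of z j] exp_ge_add_one_self[of "norm z"] by linarith
    ultimately have "cmod (coord_prim j u z) \<le> exp (norm z) * (A * exp (s * norm z))"
      unfolding coord_prim_def norm_mult by (intro mult_mono) auto
    then show ?thesis by (simp add: algebra_simps exp_add)
  qed
  then show "\<exists>A s. 0 \<le> s \<and> (\<forall>z. cmod (coord_prim j u z) \<le> A * exp (s * norm z))"
    using s by (intro exI[of _ A] exI[of _ "s + 1"]) auto
qed

lemma coord_prim_eq_contour_integral: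
  "coord_prim j u z = contour_integral (linepath 0 (z $ j)) (\<lambda>c. u (vec_upd z j c))"
  unfolding coord_prim_def contour_integral_linepath_0_1 contour_integral_integral
  by (simp add: linepath_def scaleR_conv_of_real mult.commute[of _ "z $ j"])

text \<open>On the line in direction j the integrand has a global primitive g, so the integral over
  the segment from 0 to c is g(c) - g(0).\<close>

lemma coord_prim_deriv:
  assumes u: "exp_type_entire u"
  shows "((\<lambda>c. coord_prim j u (vec_upd z j c)) has_field_derivative u (vec_upd z j c)) (at c)"
proof -
  obtain g where g: "\<And>c. (g has_field_derivative u (vec_upd z j c)) (at c)"
    using holomorphic_convex_primitive'[OF convex_UNIV open_UNIV holomorphic_vec_upd[OF u, of z j]]
    by auto
  have "coord_prim j u (vec_upd z j c) = g c - g 0" for c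
  proof -
    have "((\<lambda>c. u (vec_upd z j c)) has_contour_integral g c - g 0) (linepath 0 c)"
      using contour_integral_primitive[of UNIV g "\<lambda>c. u (vec_upd z j c)" "linepath 0 c"] g by simp
    moreover have "vec_upd (vec_upd z j c) j = vec_upd z j"
      by (simp add: fun_eq_iff vec_upd_def vec_eq_iff)
    moreover have "vec_upd z j c $ j = c" by (simp add: vec_upd_def)
    ultimately show ?thesis
      by (simp add: coord_prim_eq_contour_integral contour_integral_unique)
  qed
  then show ?thesis using g by (auto intro!: derivative_eq_intros)
qed

section \<open>Undoing antiderivatives by Cauchy estimates\<close>

text \<open>The base 2 + |z| is the shape in which the half-plane estimate arrives, namely K + 1
  with K = 1 + |x|. Radius 0 describes the real space.\<close>

definition poly_bounded_on_strip :: "real \<Rightarrow> nat \<Rightarrow> (complex ^ 'n \<Rightarrow> complex) \<Rightarrow> bool" where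
  "poly_bounded_on_strip r n u \<longleftrightarrow>
     (\<exists>C. \<forall>z. norm (\<chi> i. Im (z $ i)) \<le> r \<longrightarrow> cmod (u z) \<le> C * (2 + norm z) ^ n)"

text \<open>\<open>u\<close> is the j-th derivative of its antiderivative. On the unit circle around
  \<open>z $ j\<close> the vector and its imaginary part both move by at most 1, which costs one
  unit of radius and a factor 2^n.\<close>

lemma poly_bounded_on_strip_coord_prim:
  assumes u: "exp_type_entire u" and "poly_bounded_on_strip (r + 1) n (coord_prim j u)"
  shows "poly_bounded_on_strip r n u"
proof -
  obtain C where C: "\<And>z. norm (\<chi> i. Im (z $ i)) \<le> r + 1 \<Longrightarrow> cmod (coord_prim j u z) \<le> C * (2 + norm z) ^ n"
    using assms(2) by (auto simp: poly_bounded_on_strip_def)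
  have "cmod (u z) \<le> (\<bar>C\<bar> * 2 ^ n) * (2 + norm z) ^ n" if z: "norm (\<chi> i. Im (z $ i)) \<le> r" for z
  proof -
    define g where "g c = coord_prim j u (vec_upd z j c)" for c
    have g': "(g has_field_derivative u (vec_upd z j c)) (at c)" for c
      unfolding g_def by (rule coord_prim_deriv[OF u])
    have hol: "g holomorphic_on A" for A
      using g' by (auto simp: holomorphic_on_def field_differentiable_def intro: has_field_derivative_at_within)
    have "cmod ((deriv ^^ 1) g (z $ j)) \<le> fact 1 * ((\<bar>C\<bar> * 2 ^ n) * (2 + norm z) ^ n) / 1 ^ 1"
    proof (rule Cauchy_inequality)
      fix c assume c: "cmod (z $ j - c) = 1"
      have eq: "vec_upd z j c = z + axis j (c - z $ j)"
        by (simp add: vec_eq_iff vec_upd_def axis_def)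
      have n1: "norm (vec_upd z j c) \<le> norm z + 1"
        using norm_triangle_ineq[of z "axis j (c - z $ j)"] c by (simp add: eq norm_axis norm_minus_commute)
      have n2: "2 + norm (vec_upd z j c) \<le> 2 * (2 + norm z)"
        using n1 norm_ge_zero[of z] by argo
      have "(\<chi> i. Im (vec_upd z j c $ i)) = (\<chi> i. Im (z $ i)) + axis j (Im (c - z $ j))"
        by (simp add: eq vec_eq_iff axis_def)
      moreover have "\<bar>Im (c - z $ j)\<bar> \<le> 1" using c abs_Im_le_cmod[of "c - z $ j"] by (simp add: norm_minus_commute)
      ultimately have "norm (\<chi> i. Im (vec_upd z j c $ i)) \<le> r + 1"
        using norm_triangle_ineq[of "\<chi> i. Im (z $ i)" "axis j (Im (c - z $ j))"] z by (simp add: norm_axis)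
      then have "cmod (g c) \<le> C * (2 + norm (vec_upd z j c)) ^ n" unfolding g_def by (rule C)
      also have "\<dots> \<le> \<bar>C\<bar> * (2 * (2 + norm z)) ^ n"
        using n2 by (intro mult_mono power_mono) auto
      finally show "cmod (g c) \<le> (\<bar>C\<bar> * 2 ^ n) * (2 + norm z) ^ n"
        by (simp only: power_mult_distrib mult.assoc)
    qed (use hol holomorphic_on_imp_continuous_on[OF hol] in auto)
    moreover have "deriv g (z $ j) = u z"
    proof -
      have "vec_upd z j (z $ j) = z" by (simp add: vec_upd_def vec_eq_iff)
      then show ?thesis using DERIV_imp_deriv[OF g'[of "z $ j"]] by simp
    qed
    ultimately show ?thesis by simp
  qed
  then show ?thesis unfolding poly_bounded_on_strip_def by blast
qed

lemma poly_bounded_on_strip_fold_coord_prim: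
  assumes "exp_type_entire u" and "poly_bounded_on_strip (r + real (length js)) n (fold coord_prim js u)"
  shows "poly_bounded_on_strip r n u"
  using assms
proof (induction js arbitrary: u r)
  case (Cons j js)
  \<comment> \<open>\<open>fold\<close> applies \<open>j\<close> innermost, so the antiderivatives
    in \<open>js\<close> are undone before it, down to radius r + 1; hence the induction varies both
    \<open>u\<close> and \<open>r\<close>.\<close>
  have "poly_bounded_on_strip (r + 1) n (coord_prim j u)"
    using Cons.prems by (intro Cons.IH[of "coord_prim j u"]) (auto simp: add_ac intro: coord_prim_exp_type_entire)
  then show ?case by (rule poly_bounded_on_strip_coord_prim[OF Cons.prems(1)])
qed simp

lemma exp_type_entire_fold_coord_prim:
  "exp_type_entire u \<Longrightarrow> exp_type_entire (fold coord_prim js u)"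
  by (induction js arbitrary: u) (auto intro: coord_prim_exp_type_entire)

subsection \<open>Bounds on the real space\<close>

lemma cvec_of_rvec_vec_upd:
  "cvec_of_rvec (vec_upd x j t) = vec_upd (cvec_of_rvec x) j (of_real t)"
  by (simp add: cvec_of_rvec_def vec_upd_def vec_eq_iff)

text \<open>The interval [-T, T] covers both signs of \<open>x $ j\<close> and does not depend on x,
  so the bounds can be iterated; nonnegative integrals spare integrability conditions in the
  iteration.\<close>

lemma norm_coord_prim_real_le:
  fixes u :: "complex ^ 'n \<Rightarrow> complex" and x :: "real ^ 'n"
  assumes u: "exp_type_entire u" and x: "\<bar>x $ j\<bar> \<le> T"
  shows "ennreal (cmod (coord_prim j u (cvec_of_rvec x))) \<le>
    (\<integral>\<^sup>+t. ennreal (cmod (u (cvec_of_rvec (vec_upd x j t)))) * indicator {-T..T} t \<partial>lborel)"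
proof -
  define f where "f c = u (vec_upd (cvec_of_rvec x) j c)" for c
  have "continuous_on UNIV f"
    unfolding f_def by (rule holomorphic_on_imp_continuous_on[OF holomorphic_vec_upd[OF u]])
  then have cont: "continuous_on A (\<lambda>t. f (of_real t))" for A
    by (rule continuous_on_compose2) (auto intro: continuous_intros)
  have int: "(\<lambda>t. f (of_real t)) integrable_on {a..b}" "(\<lambda>t. cmod (f (of_real t))) integrable_on {a..b}" for a b
    by (intro integrable_continuous_interval continuous_intros cont)+
  have le: "cmod (integral {a..b} (\<lambda>t. f (of_real t))) \<le> integral {-T..T} (\<lambda>t. cmod (f (of_real t)))"
    if "-T \<le> a" "b \<le> T" for a b
  proof -
    have "cmod (integral {a..b} (\<lambda>t. f (of_real t))) \<le> integral {a..b} (\<lambda>t. cmod (f (of_real t)))"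
      by (rule integral_norm_bound_integral[OF int]) simp
    also have "\<dots> \<le> integral {-T..T} (\<lambda>t. cmod (f (of_real t)))"
      by (rule integral_subset_le[OF _ int(2) int(2)]) (use that in auto)
    finally show ?thesis .
  qed
  define r where "r = x $ j"
  have prim: "coord_prim j u (cvec_of_rvec x) = contour_integral (linepath 0 (of_real r)) f"
    by (simp add: coord_prim_eq_contour_integral f_def[abs_def] r_def cvec_of_rvec_def)
  have "cmod (coord_prim j u (cvec_of_rvec x)) \<le> integral {-T..T} (\<lambda>t. cmod (f (of_real t)))"
  proof (cases r "0 :: real" rule: linorder_cases)
    case less
    have "contour_integral (linepath (of_real r) 0) f = integral {r..0} (\<lambda>t. f (of_real t))"
      using less by (subst contour_integral_linepath_Reals_eq) auto
    then have "coord_prim j u (cvec_of_rvec x) = - integral {r..0} (\<lambda>t. f (of_real t))"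
      using contour_integral_reversepath[OF valid_path_linepath, of "of_real r" 0 f]
      unfolding prim reversepath_linepath by simp
    then show ?thesis using le[of r 0] less x by (simp add: r_def)
  next
    case equal
    then show ?thesis using le[of 0 0] x by (simp add: prim)
  next
    case greater
    have "contour_integral (linepath 0 (of_real r)) f = integral {0..r} (\<lambda>t. f (of_real t))"
      using greater by (subst contour_integral_linepath_Reals_eq) auto
    then show ?thesis using le[of 0 r] greater x by (simp add: prim r_def)
  qed
  also have "ennreal (integral {-T..T} (\<lambda>t. cmod (f (of_real t)))) =
      (\<integral>\<^sup>+t. ennreal (cmod (f (of_real t))) * indicator {-T..T} t \<partial>lborel)"
    by (rule nn_integral_has_integral_lebesgue'[symmetric]) (auto intro: integrable_integral int)
  finally show ?thesis by (simp add: ennreal_leI f_def cvec_of_rvec_vec_upd)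
qed

section \<open>Iterated integration and Lebesgue measure on the cube\<close>

text \<open>Coordinates in \<open>J\<close> are integration variables, given as a point of a product
  space; the others stay frozen at \<open>x\<close>.\<close>

definition vec_merge :: "'n set \<Rightarrow> 'a ^ 'n \<Rightarrow> ('n \<Rightarrow> 'a) \<Rightarrow> 'a ^ 'n" where
  "vec_merge J x y = (\<chi> i. if i \<in> J then y i else x $ i)"

lemma measurable_vec_lambda:
  fixes f :: "'a \<Rightarrow> 'n::finite \<Rightarrow> real"
  assumes "\<And>i. (\<lambda>y. f y i) \<in> borel_measurable M"
  shows "(\<lambda>y. \<chi> i. f y i) \<in> borel_measurable M"
proof (rule borel_measurable_euclidean_space[THEN iffD2], rule ballI)
  fix b :: "real ^ 'n" assume "b \<in> Basis"
  then obtain k where "b = axis k 1" by (auto simp: Basis_vec_def)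
  then show "(\<lambda>y. (\<chi> i. f y i) \<bullet> b) \<in> borel_measurable M"
    using assms[of k] by (simp add: inner_axis)
qed

lemma continuous_on_cvec_of_rvec: "continuous_on A cvec_of_rvec"
  unfolding cvec_of_rvec_def by (intro continuous_intros continuous_on_vec_lambda)

lemma measurable_comp_cvec_of_rvec:
  assumes "exp_type_entire u"
  shows "(\<lambda>x. u (cvec_of_rvec x)) \<in> borel_measurable borel"
  using continuous_on_compose2[OF exp_type_entireD(1)[OF assms] continuous_on_cvec_of_rvec]
  by (rule borel_measurable_continuous_onI) simp

lemma measurable_comp_vec_merge:
  fixes u :: "complex ^ 'n \<Rightarrow> complex"
  assumes "exp_type_entire u"
  shows "(\<lambda>y. u (cvec_of_rvec (vec_merge J x y))) \<in> borel_measurable (Pi\<^sub>M J (\<lambda>_. lborel))"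
proof -
  have "(\<lambda>y. if i \<in> J then y i else x $ i) \<in> borel_measurable (Pi\<^sub>M J (\<lambda>_. lborel))" for i
    by (cases "i \<in> J") auto
  then have "(\<lambda>y. vec_merge J x y) \<in> borel_measurable (Pi\<^sub>M J (\<lambda>_. lborel))"
    unfolding vec_merge_def by (rule measurable_vec_lambda)
  then show ?thesis by (rule measurable_compose[OF _ measurable_comp_cvec_of_rvec[OF assms]])
qed

lemma norm_fold_coord_prim_real_le:
  fixes u :: "complex ^ 'n \<Rightarrow> complex" and x :: "real ^ 'n"
  assumes "distinct js" and "exp_type_entire u" and x: "\<And>i. \<bar>x $ i\<bar> \<le> T"
  shows "ennreal (cmod (fold coord_prim js u (cvec_of_rvec x))) \<le>
    (\<integral>\<^sup>+y. ennreal (cmod (u (cvec_of_rvec (vec_merge (set js) x y)))) *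
      (\<Prod>i\<in>set js. indicator {-T..T} (y i)) \<partial>Pi\<^sub>M (set js) (\<lambda>_. lborel))"
  using assms(1,2)
proof (induction js arbitrary: u)
  interpret product_sigma_finite "\<lambda>_ :: 'n. lborel :: real measure" by standard
  case Nil
  then show ?case by (simp add: PiM_empty vec_merge_def vec_lambda_eta)
next
  interpret product_sigma_finite "\<lambda>_ :: 'n. lborel :: real measure" by standard
  case (Cons j js)
  define J where "J = set js"
  have J: "j \<notin> J" "finite J" using Cons.prems by (auto simp: J_def)
  let ?ind = "\<lambda>J y. \<Prod>i\<in>J. indicator {-T..T} (y i) :: ennreal"
  let ?g = "\<lambda>y. ennreal (cmod (u (cvec_of_rvec (vec_merge (insert j J) x y)))) * ?ind (insert j J) y"
  have "ennreal (cmod (fold coord_prim (j # js) u (cvec_of_rvec x))) \<le>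
      (\<integral>\<^sup>+y. ennreal (cmod (coord_prim j u (cvec_of_rvec (vec_merge J x y)))) * ?ind J y \<partial>Pi\<^sub>M J (\<lambda>_. lborel))"
    using Cons.IH[of "coord_prim j u"] Cons.prems by (simp add: coord_prim_exp_type_entire J_def)
  also have "\<dots> \<le> (\<integral>\<^sup>+y. (\<integral>\<^sup>+t. ?g (y(j := t)) \<partial>lborel) \<partial>Pi\<^sub>M J (\<lambda>_. lborel))"
  proof (rule nn_integral_mono)
    fix y
    have upd: "vec_upd (vec_merge J x y) j t = vec_merge (insert j J) x (y(j := t))" for t
      using J by (auto simp: vec_upd_def vec_merge_def vec_eq_iff)
    have ind: "?ind (insert j J) (y(j := t)) = indicator {-T..T} t * ?ind J y" for t
    proof -
      have "?ind J (y(j := t)) = ?ind J y" using J by (intro prod.cong) auto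
      then show ?thesis using J by simp
    qed
    have "(\<lambda>c. u (vec_upd (cvec_of_rvec (vec_merge J x y)) j c)) \<in> borel_measurable borel"
      by (intro borel_measurable_continuous_onI holomorphic_on_imp_continuous_on holomorphic_vec_upd Cons.prems)
    then have [measurable]: "(\<lambda>t. u (cvec_of_rvec (vec_upd (vec_merge J x y) j t))) \<in> borel_measurable borel"
      unfolding cvec_of_rvec_vec_upd by (rule measurable_compose[rotated]) measurable
    \<comment> \<open>As \<open>j\<close> is not in \<open>J\<close>, the j-th coordinate of the
      merged vector is still \<open>x $ j\<close>, hence at most \<open>T\<close> in
      modulus.\<close>
    have "ennreal (cmod (coord_prim j u (cvec_of_rvec (vec_merge J x y)))) \<le>
      (\<integral>\<^sup>+t. ennreal (cmod (u (cvec_of_rvec (vec_upd (vec_merge J x y) j t)))) * indicator {-T..T} t \<partial>lborel)"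
      using Cons.prems J x by (intro norm_coord_prim_real_le) (auto simp: vec_merge_def)
    then have "ennreal (cmod (coord_prim j u (cvec_of_rvec (vec_merge J x y)))) * ?ind J y \<le>
      (\<integral>\<^sup>+t. ennreal (cmod (u (cvec_of_rvec (vec_upd (vec_merge J x y) j t)))) * indicator {-T..T} t \<partial>lborel) * ?ind J y"
      by (rule mult_right_mono) simp
    also have "\<dots> = (\<integral>\<^sup>+t. ?g (y(j := t)) \<partial>lborel)"
      by (subst nn_integral_multc[symmetric]) (auto simp: upd[symmetric] ind mult.assoc simp del: prod.insert fun_upd_apply)
    finally show "ennreal (cmod (coord_prim j u (cvec_of_rvec (vec_merge J x y)))) * ?ind J y \<le>
      (\<integral>\<^sup>+t. ?g (y(j := t)) \<partial>lborel)" .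
  qed
  also have "\<dots> = (\<integral>\<^sup>+y. ?g y \<partial>Pi\<^sub>M (insert j J) (\<lambda>_. lborel))"
  proof (rule product_nn_integral_insert[symmetric])
    have "(\<lambda>y. cmod (u (cvec_of_rvec (vec_merge (insert j J) x y)))) \<in>
        borel_measurable (Pi\<^sub>M (insert j J) (\<lambda>_. lborel))"
      by (rule measurable_compose[OF measurable_comp_vec_merge[OF Cons.prems(2)] borel_measurable_norm])
    then show "?g \<in> borel_measurable (Pi\<^sub>M (insert j J) (\<lambda>_. lborel))"
    proof (intro borel_measurable_times_ennreal borel_measurable_prod_ennreal)
      fix i assume "i \<in> insert j J"
      then show "(\<lambda>y. indicator {-T..T} (y i)) \<in> borel_measurable (Pi\<^sub>M (insert j J) (\<lambda>_. lborel))"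
        by (intro measurable_compose[OF measurable_component_singleton]) auto
    qed (rule measurable_compose[OF _ measurable_ennreal])
  qed (use J in auto)
  finally show ?case by (simp add: J_def)
qed

text \<open>Both measures agree on boxes, which determine \<open>lborel\<close>. This links Fubini
  on products indexed by coordinates with the integral over vectors in the Besicovitch norm.\<close>

lemma distr_PiM_lborel_vec:
  "distr (Pi\<^sub>M UNIV (\<lambda>_::'n::finite. lborel)) borel (\<lambda>y. \<chi> i. y i) = (lborel :: (real ^ 'n) measure)"
proof (rule lborel_eqI[symmetric])
  interpret product_sigma_finite "\<lambda>_ :: 'n. lborel :: real measure" by standard
  have [measurable]: "(\<lambda>y. \<chi> i. y i) \<in> borel_measurable (Pi\<^sub>M UNIV (\<lambda>_::'n. lborel :: real measure))"
    by (rule measurable_vec_lambda) simp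
  fix l u :: "real ^ 'n" assume le: "\<And>b. b \<in> Basis \<Longrightarrow> l \<bullet> b \<le> u \<bullet> b"
  have lu: "l $ i \<le> u $ i" for i
    using le[of "axis i 1"] by (auto simp: Basis_vec_def inner_axis)
  have "(\<lambda>y. \<chi> i. y i) -` box l u \<inter> space (Pi\<^sub>M UNIV (\<lambda>_::'n. lborel)) = Pi\<^sub>E UNIV (\<lambda>i. {l $ i <..< u $ i})"
    by (auto simp: mem_box_cart space_PiM PiE_def Pi_def)
  then have "emeasure (distr (Pi\<^sub>M UNIV (\<lambda>_::'n. lborel)) borel (\<lambda>y. \<chi> i. y i)) (box l u) =
      (\<Prod>i\<in>UNIV. emeasure lborel {l $ i <..< u $ i})"
    by (simp add: emeasure_distr emeasure_PiM)
  also have "\<dots> = ennreal (\<Prod>i\<in>UNIV. u $ i - l $ i)"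
    using lu by (simp add: prod_ennreal)
  also have "(\<Prod>i\<in>UNIV. u $ i - l $ i) = (\<Prod>b\<in>Basis. (u - l) \<bullet> b)"
    by (simp add: Basis_vec_def cart_eq_inner_axis axis_eq_axis prod.UNION_disjoint inner_diff_left)
  finally show "emeasure (distr (Pi\<^sub>M UNIV (\<lambda>_::'n. lborel)) borel (\<lambda>y. \<chi> i. y i)) (box l u) =
      ennreal (\<Prod>b\<in>Basis. (u - l) \<bullet> b)" .
qed simp

lemma norm_fold_coord_prim_le_set_integral:
  fixes F :: "complex ^ 'n \<Rightarrow> complex" and x :: "real ^ 'n"
  assumes F: "exp_type_entire F" and js: "distinct js" "set js = UNIV" and x: "\<And>i. \<bar>x $ i\<bar> \<le> T"
    and int: "locally_integrable (\<lambda>x. F (cvec_of_rvec x))"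
  shows "cmod (fold coord_prim js F (cvec_of_rvec x)) \<le>
    (LINT v : cbox (- (\<chi> i. T)) (\<chi> i. T) | lborel. norm (F (cvec_of_rvec v)))"
proof -
  let ?Q = "cbox (- (\<chi> i. T)) (\<chi> i. T) :: (real ^ 'n) set"
  let ?h = "\<lambda>v. ennreal (cmod (F (cvec_of_rvec v))) * indicator ?Q v"
  have [measurable]: "(\<lambda>y. \<chi> i. y i) \<in> borel_measurable (Pi\<^sub>M UNIV (\<lambda>_::'n. lborel :: real measure))"
    by (rule measurable_vec_lambda) simp
  note [measurable] = measurable_comp_cvec_of_rvec[OF F]
  have ind: "(\<Prod>i\<in>UNIV. indicator {-T..T} (y i)) = (indicator ?Q (\<chi> i. y i) :: ennreal)" for y
  proof (cases "\<forall>i. y i \<in> {-T..T}")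
    case True then show ?thesis by (auto simp: mem_box_cart)
  next
    case False
    then obtain i where "y i \<notin> {-T..T}" by blast
    then have "indicator {-T..T} (y i) = (0 :: ennreal)" by (simp only: indicator_def) simp
    then have "(\<Prod>i\<in>UNIV. indicator {-T..T} (y i)) = (0 :: ennreal)"
      by (intro prod_zero) auto
    with False show ?thesis by (auto simp: mem_box_cart indicator_def)
  qed
  have "ennreal (cmod (fold coord_prim js F (cvec_of_rvec x))) \<le>
      (\<integral>\<^sup>+y. ?h (\<chi> i. y i) \<partial>Pi\<^sub>M UNIV (\<lambda>_. lborel))"
    using norm_fold_coord_prim_real_le[OF js(1) F x] by (simp add: js ind vec_merge_def)
  also have "\<dots> = (\<integral>\<^sup>+v. ?h v \<partial>lborel)"
    unfolding distr_PiM_lborel_vec[symmetric] by (subst nn_integral_distr) measurable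
  also have "\<dots> = (\<integral>\<^sup>+v. ennreal (indicator ?Q v *\<^sub>R cmod (F (cvec_of_rvec v))) \<partial>lborel)"
    by (intro nn_integral_cong) (auto simp: indicator_def)
  also have "\<dots> = ennreal (LINT v : ?Q | lborel. norm (F (cvec_of_rvec v)))"
    unfolding set_lebesgue_integral_def
  proof (rule nn_integral_eq_integral)
    have "set_integrable lborel ?Q (\<lambda>v. norm (F (cvec_of_rvec v)))"
      using int by (intro set_integrable_norm) (auto simp: locally_integrable_def)
    then show "integrable lborel (\<lambda>v. indicator ?Q v *\<^sub>R cmod (F (cvec_of_rvec v)))"
      by (simp add: set_integrable_def)
  qed simp
  finally show ?thesis
    by (subst (asm) ennreal_le_iff) (auto simp: set_lebesgue_integral_def intro!: integral_nonneg_AE)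
qed

text \<open>The limsup says something only beyond some T0. Enlarging the cube by a fixed factor K
  \<ge> T0 reaches that range from every T \<ge> 1, and monotonicity in T transfers the bound back
  at the price of K^p.\<close>

lemma besicovitch_norm_finite_imp_cube_bound:
  fixes f :: "real ^ 'n \<Rightarrow> complex"
  assumes int: "locally_integrable f" and fin: "besicovitch_norm f < \<infinity>"
  obtains M where "\<And>T. 1 \<le> T \<Longrightarrow>
    (LINT x : cbox (- (\<chi> i. T)) (\<chi> i. T) | lborel. norm (f x)) \<le> M * T ^ CARD('n)"
proof -
  define I where "I T = (LINT x : cbox (- (\<chi> i. T)) (\<chi> i. T) | lborel. norm (f x))" for T
  have mono: "I S \<le> I T" if "S \<le> T" for S T
    unfolding I_def set_lebesgue_integral_def
  proof (rule integral_mono)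
    have "integrable lborel (\<lambda>x. indicator (cbox (- (\<chi> i. T)) (\<chi> i. T)) x *\<^sub>R norm (f x))" for T
      using int set_integrable_norm unfolding locally_integrable_def set_integrable_def by blast
    then show "integrable lborel (\<lambda>x. indicator (cbox (- (\<chi> i. S)) (\<chi> i. S)) x *\<^sub>R norm (f x))"
      "integrable lborel (\<lambda>x. indicator (cbox (- (\<chi> i. T)) (\<chi> i. T)) x *\<^sub>R norm (f x))"
      by simp_all
    have "cbox (- (\<chi> i. S)) (\<chi> i. S) \<subseteq> (cbox (- (\<chi> i. T)) (\<chi> i. T) :: (real ^ 'n) set)"
    proof
      fix x assume "x \<in> cbox (- (\<chi> i. S)) (\<chi> i. S)"
      then have "- S \<le> x $ i \<and> x $ i \<le> S" for i by (simp add: mem_box_cart)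
      then have "- T \<le> x $ i \<and> x $ i \<le> T" for i using that by (meson neg_le_iff_le order_trans)
      then show "x \<in> cbox (- (\<chi> i. T)) (\<chi> i. T)" by (simp add: mem_box_cart)
    qed
    then show "indicator (cbox (- (\<chi> i. S)) (\<chi> i. S)) x *\<^sub>R norm (f x) \<le>
        indicator (cbox (- (\<chi> i. T)) (\<chi> i. T)) x *\<^sub>R norm (f x)" for x
      by (auto simp: indicator_def)
  qed
  obtain r where "besicovitch_norm f < ereal r" using fin ereal_dense2 by blast
  moreover have "\<forall>y>besicovitch_norm f. \<forall>\<^sub>F T in at_top. ereal ((2 * T) powr (- real CARD('n)) * I T) < y"
    unfolding besicovitch_norm_def I_def by (rule Limsup_le_iff[THEN iffD1, OF order_refl])
  ultimately have "\<forall>\<^sub>F T in at_top. ereal ((2 * T) powr (- real CARD('n)) * I T) < ereal r" by blast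
  then obtain T0 where T0: "\<And>T. T \<ge> T0 \<Longrightarrow> (2 * T) powr (- real CARD('n)) * I T < r"
    by (auto simp: eventually_at_top_linorder)
  define K where "K = max 1 T0"
  have "I T \<le> (r * (2 * K) ^ CARD('n)) * T ^ CARD('n)" if T: "1 \<le> T" for T
  proof -
    have K: "1 \<le> K" "T0 \<le> K" by (auto simp: K_def)
    have "T \<le> T * K" "K \<le> T * K" using K T mult_left_mono[of 1 K T] mult_right_mono[of 1 T K] by auto
    then have "(2 * (T * K)) powr (- real CARD('n)) * I (T * K) < r" using K by (intro T0) linarith
    moreover have "0 < 2 * (T * K)" using K T by simp
    ultimately have "I (T * K) / (2 * (T * K)) ^ CARD('n) < r"
      by (simp only: powr_minus powr_realpow) (simp add: divide_inverse mult.commute)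
    then have "I (T * K) \<le> r * (2 * (T * K)) ^ CARD('n)"
      using \<open>0 < 2 * (T * K)\<close> by (simp only: pos_divide_less_eq[OF zero_less_power] less_imp_le)
    with mono[OF \<open>T \<le> T * K\<close>] show ?thesis by (simp add: power_mult_distrib mult_ac)
  qed
  then show thesis unfolding I_def by (rule that)
qed

subsection \<open>From the real space to a strip\<close>

lemma norm_cvec_of_rvec: "norm (cvec_of_rvec x) = norm x"
  by (simp add: cvec_of_rvec_def norm_vec_def)

text \<open>The one-variable estimate is applied to w -> x + w y with K = 1 + |x|. Along this line
  the type is at most s r, since |y| \<le> r.\<close>

lemma poly_bounded_on_strip_if_real:
  fixes u :: "complex ^ 'n \<Rightarrow> complex"
  assumes u: "exp_type_entire u" and D: "\<And>x. cmod (u (cvec_of_rvec x)) \<le> D * (1 + norm x) ^ n"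
    and r: "1 \<le> r"
  shows "poly_bounded_on_strip r n u"
proof -
  obtain A s where s: "0 \<le> s" and A: "\<And>z. cmod (u z) \<le> A * exp (s * norm z)"
    using u by (auto simp: exp_type_entire_def)
  have "0 \<le> A" using order_trans[OF norm_ge_zero A[of 0]] by simp
  have "0 \<le> D" using order_trans[OF norm_ge_zero D[of 0]] by simp
  define C where "C = D * r ^ n * 2 ^ n * exp (s * r)"
  have "cmod (u z) \<le> C * (2 + norm z) ^ n" if z: "norm (\<chi> i. Im (z $ i)) \<le> r" for z
  proof -
    define x y :: "real ^ 'n" where "x = (\<chi> i. Re (z $ i))" and "y = (\<chi> i. Im (z $ i))"
    define f where "f w = u (\<chi> i. cvec_of_rvec x $ i + w * cvec_of_rvec y $ i)" for w
    have f_ii: "f \<i> = u z"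
    proof -
      have "(\<chi> i. cvec_of_rvec x $ i + \<i> * cvec_of_rvec y $ i) = z"
        by (simp add: vec_eq_iff cvec_of_rvec_def x_def y_def complex_eq_iff)
      then show ?thesis by (simp add: f_def)
    qed
    have y: "norm y \<le> r" using z by (simp add: y_def)
    have "cmod (f \<i>) \<le> (D * r ^ n) * 2 ^ n * ((1 + norm x) + 1) ^ n * exp (s * r)"
    proof (rule exponential_type_bound_at_ii)
      show "f holomorphic_on UNIV" unfolding f_def by (rule exp_type_entireD(2)[OF u])
      \<comment> \<open>The factor depending on x is harmless: the growth constant is absent from
        the conclusion at i.\<close>
      show "cmod (f w) \<le> (A * exp (s * norm x)) * exp (s * r * cmod w)" for w
      proof -
        have eq: "(\<chi> i. cvec_of_rvec x $ i + w * cvec_of_rvec y $ i) = cvec_of_rvec x + w *s cvec_of_rvec y"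
          by (simp add: vec_eq_iff)
        have "norm (w *s cvec_of_rvec y) = cmod w * norm y"
          by (simp add: norm_vec_def cvec_of_rvec_def norm_mult L2_set_right_distrib)
        also have "\<dots> \<le> cmod w * r" using y by (rule mult_left_mono) simp
        finally have "norm (cvec_of_rvec x + w *s cvec_of_rvec y) \<le> norm x + cmod w * r"
          using norm_triangle_ineq[of "cvec_of_rvec x" "w *s cvec_of_rvec y"] by (simp add: norm_cvec_of_rvec)
        then have "s * norm (cvec_of_rvec x + w *s cvec_of_rvec y) \<le> s * (norm x + cmod w * r)"
          using s by (rule mult_left_mono)
        then have "cmod (f w) \<le> A * exp (s * (norm x + cmod w * r))"
          unfolding f_def eq using \<open>0 \<le> A\<close> by (intro order_trans[OF A] mult_left_mono) auto
        then show ?thesis by (simp add: algebra_simps exp_add)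
      qed
      show "cmod (f (of_real t)) \<le> (D * r ^ n) * ((1 + norm x) + \<bar>t\<bar>) ^ n" for t
      proof -
        have "(\<chi> i. cvec_of_rvec x $ i + of_real t * cvec_of_rvec y $ i) = cvec_of_rvec (x + t *\<^sub>R y)"
          by (simp add: vec_eq_iff cvec_of_rvec_def)
        then have "cmod (f (of_real t)) \<le> D * (1 + norm (x + t *\<^sub>R y)) ^ n"
          using D by (simp add: f_def)
        also have "\<dots> \<le> D * (r * ((1 + norm x) + \<bar>t\<bar>)) ^ n"
        proof (intro mult_left_mono power_mono)
          have "norm (x + t *\<^sub>R y) \<le> norm x + \<bar>t\<bar> * norm y"
            using norm_triangle_ineq[of x "t *\<^sub>R y"] by simp
          also have "\<dots> \<le> norm x + \<bar>t\<bar> * r" using y by (intro add_left_mono mult_left_mono) auto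
          also have "1 * (1 + norm x) \<le> r * (1 + norm x)" using r by (intro mult_right_mono) auto
          then have "norm x + \<bar>t\<bar> * r \<le> r * ((1 + norm x) + \<bar>t\<bar>) - 1" by (simp add: algebra_simps)
          finally show "1 + norm (x + t *\<^sub>R y) \<le> r * ((1 + norm x) + \<bar>t\<bar>)" by simp
        qed (use \<open>0 \<le> D\<close> in auto)
        finally show ?thesis by (simp add: power_mult_distrib mult_ac)
      qed
    qed (use s r in auto)
    also have "\<dots> = C * (2 + norm x) ^ n" by (simp add: C_def mult_ac)
    also have "norm x \<le> norm z"
      unfolding x_def by (rule norm_le_componentwise_cart) (simp add: abs_Re_le_cmod)
    then have "C * (2 + norm x) ^ n \<le> C * (2 + norm z) ^ n"
      using \<open>0 \<le> D\<close> r by (intro mult_left_mono power_mono) (auto simp: C_def)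
    finally show ?thesis by (simp add: f_ii)
  qed
  then show ?thesis unfolding poly_bounded_on_strip_def by blast
qed

section \<open>From the hypotheses on the function to the product bound\<close>

lemma entire_cn_imp_exp_type_entire:
  fixes F :: "complex ^ 'n \<Rightarrow> complex"
  assumes F: "entire_cn F" and "0 \<le> s" and "\<And>z. norm (F z) \<le> A * exp (s * norm z)"
  shows "exp_type_entire F"
  unfolding exp_type_entire_def
proof (intro conjI allI)
  obtain a where a: "\<And>z. (F has_derivative (\<lambda>h. \<Sum>i\<in>UNIV. a z $ i * h $ i)) (at z)"
    using F unfolding entire_cn_def by metis
  show "continuous_on UNIV F"
    using has_derivative_continuous[OF a] by (intro continuous_at_imp_continuous_on) auto
  show "\<exists>A s. 0 \<le> s \<and> (\<forall>z. cmod (F z) \<le> A * exp (s * norm z))" using assms by blast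
  fix x y :: "complex ^ 'n"
  have "((\<lambda>w. F (\<chi> i. x $ i + w * y $ i)) has_field_derivative
      (\<Sum>i\<in>UNIV. a (\<chi> i. x $ i + w * y $ i) $ i * y $ i)) (at w)" for w
  proof -
    have "((\<lambda>w. \<chi> i. x $ i + w * y $ i) has_derivative (\<lambda>h. \<chi> i. h * y $ i)) (at w)"
    proof -
      have "linear (\<lambda>h. \<chi> i. h * y $ i)" by (rule linearI) (auto simp: vec_eq_iff algebra_simps)
      then have "((\<lambda>w. x + (\<chi> i. w * y $ i)) has_derivative (\<lambda>h. \<chi> i. h * y $ i)) (at w)"
        by (auto intro!: derivative_eq_intros bounded_linear_imp_has_derivative simp: linear_conv_bounded_linear)
      moreover have "(\<lambda>w. x + (\<chi> i. w * y $ i)) = (\<lambda>w. \<chi> i. x $ i + w * y $ i)"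
        by (simp add: fun_eq_iff vec_eq_iff)
      ultimately show ?thesis by simp
    qed
    from has_derivative_compose[OF this a]
    show ?thesis
      unfolding has_field_derivative_def
      by (rule has_derivative_eq_rhs) (simp add: fun_eq_iff sum_distrib_right sum_distrib_left mult_ac)
  qed
  then show "(\<lambda>w. F (\<chi> i. x $ i + w * y $ i)) holomorphic_on UNIV"
    by (auto simp: holomorphic_on_def field_differentiable_def)
qed

text \<open>Expanding the product yields the left side plus nonnegative mixed terms.\<close>

lemma one_plus_sum_le_prod:
  fixes a :: "'b \<Rightarrow> real"
  assumes "finite S" and "\<And>i. 0 \<le> a i"
  shows "1 + (\<Sum>i\<in>S. a i) \<le> (\<Prod>i\<in>S. 1 + a i)"
  using assms(1)
proof induction
  case (insert i S)
  have "0 \<le> (\<Sum>i\<in>S. a i)" using assms(2) by (simp add: sum_nonneg)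
  then have "1 + a i + (\<Sum>i\<in>S. a i) \<le> (1 + a i) * (1 + (\<Sum>i\<in>S. a i))"
    using assms(2)[of i] by (simp add: algebra_simps)
  also have "\<dots> \<le> (1 + a i) * (\<Prod>i\<in>S. 1 + a i)"
    using insert.IH assms(2)[of i] by (intro mult_left_mono) auto
  finally show ?case using insert.hyps by (simp add: algebra_simps)
qed simp

theorem theorem2:
  fixes F :: "complex ^ 'n \<Rightarrow> complex" and \<sigma> C0 :: real
  assumes "\<sigma> > 0" and "C0 > 0"
    and "locally_integrable (\<lambda>x. F (cvec_of_rvec x))"
    and "besicovitch_norm (\<lambda>x. F (cvec_of_rvec x)) < \<infinity>"
    and "entire_cn F"
    and "\<And>z. norm (F z) \<le> C0 * exp (\<sigma> * norm z)"
  shows "\<exists>C1. \<forall>x :: real ^ 'n.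
           norm (F (cvec_of_rvec x)) \<le> C1 * (\<Prod>j\<in>UNIV. (1 + \<bar>x $ j\<bar>) ^ CARD('n))"
proof -
  let ?p = "CARD('n)"
  have F: "exp_type_entire F"
    using assms by (intro entire_cn_imp_exp_type_entire[of F \<sigma> C0]) auto
  obtain js :: "'n list" where js: "set js = UNIV" "distinct js"
    using finite_distinct_list[of "UNIV :: 'n set"] by auto
  then have len: "length js = ?p" by (metis distinct_card)
  obtain M where M: "\<And>T. 1 \<le> T \<Longrightarrow>
      (LINT x : cbox (- (\<chi> i. T)) (\<chi> i. T) | lborel. norm (F (cvec_of_rvec x))) \<le> M * T ^ ?p"
    using besicovitch_norm_finite_imp_cube_bound[OF assms(3,4)] by blast
  \<comment> \<open>The cube with T = 1 + |x| contains x and satisfies the requirement T \<ge> 1 of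
    \<open>M\<close>.\<close>
  have "cmod (fold coord_prim js F (cvec_of_rvec x)) \<le> M * (1 + norm x) ^ ?p" for x
  proof (rule order_trans[OF norm_fold_coord_prim_le_set_integral[OF F js(2,1) _ assms(3)] M])
    show "\<bar>x $ i\<bar> \<le> 1 + norm x" for i using component_le_norm_cart[of x i] by linarith
  qed simp
  \<comment> \<open>The first \<open>?p\<close> is the radius, one unit per antiderivative to be
    undone; the second is the degree inherited from the volume of the cube.\<close>
  then have "poly_bounded_on_strip ?p ?p (fold coord_prim js F)"
    by (intro poly_bounded_on_strip_if_real exp_type_entire_fold_coord_prim F) (auto simp: Suc_le_eq)
  then have "poly_bounded_on_strip 0 ?p F"
    by (intro poly_bounded_on_strip_fold_coord_prim[OF F, of 0 js]) (simp add: len)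
  then obtain C where C: "\<And>z. norm (\<chi> i. Im (z $ i)) \<le> 0 \<Longrightarrow> cmod (F z) \<le> C * (2 + norm z) ^ ?p"
    by (auto simp: poly_bounded_on_strip_def)
  have "norm (F (cvec_of_rvec x)) \<le> (\<bar>C\<bar> * 2 ^ ?p) * (\<Prod>j\<in>UNIV. (1 + \<bar>x $ j\<bar>) ^ ?p)" for x :: "real ^ 'n"
  proof -
    have "norm x \<le> (\<Sum>j\<in>UNIV. \<bar>x $ j\<bar>)" by (rule norm_le_l1_cart)
    moreover have "1 + (\<Sum>j\<in>UNIV. \<bar>x $ j\<bar>) \<le> (\<Prod>j\<in>UNIV. 1 + \<bar>x $ j\<bar>)"
      by (rule one_plus_sum_le_prod) auto
    moreover have "0 \<le> (\<Sum>j\<in>UNIV. \<bar>x $ j\<bar>)" by (simp add: sum_nonneg)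
    ultimately have le: "2 + norm x \<le> 2 * (\<Prod>j\<in>UNIV. 1 + \<bar>x $ j\<bar>)" by linarith
    have "(\<chi> i. Im (cvec_of_rvec x $ i)) = 0" by (simp add: vec_eq_iff cvec_of_rvec_def)
    then have "norm (F (cvec_of_rvec x)) \<le> C * (2 + norm x) ^ ?p"
      using C[of "cvec_of_rvec x"] by (simp add: norm_cvec_of_rvec)
    also have "\<dots> \<le> \<bar>C\<bar> * (2 * (\<Prod>j\<in>UNIV. 1 + \<bar>x $ j\<bar>)) ^ ?p"
      using le by (intro mult_mono power_mono) auto
    finally show ?thesis by (simp add: power_mult_distrib prod_power_distrib mult_ac)
  qed
  then show ?thesis by blast
qed

end
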